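(* Let ${\bf V}$ be the $N\times N$ random Vandermonde matrix whose phases $\theta_1,\dots,\theta_N$ are i.i.d. with law $\nu$, where $\nu$ is absolutely continuous on $[-\pi,\pi]$ with bounded density $f\in L^\infty([-\pi,\pi])$, and let $\lambda_N$ be the largest eigenvalue of ${\bf V}^*{\bf V}$. Set $C=4\pi\|f\|_\infty(e-1)+1$. There is a constant $K>0$, independent of $\epsilon,\kappa,u,N$, such that for every $\epsilon>0$ and $\kappa\in(0,1)$ there exists $N(\kappa,\epsilon)$ with $$\mathbb{P}\big(\lambda_N\ge (C+\epsilon)\log N+u\big)\le K\frac{e^{-u}}{N^{\epsilon\kappa}}$$ for all $u\ge0$ and all $N>N(\kappa,\epsilon)$.
   Context: ${\bf V}=N^{-1/2}(e^{-j(k-1)\theta_l})_{1\le k,l\le N}$. *)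

theory Defs
  imports "HOL-Probability.Probability" "Jordan_Normal_Form.Schur_Decomposition"
begin

text \<open>The N x N random Vandermonde matrix, 0-indexed:
  V(k,l) = N^(-1/2) exp(-i k theta_l), k,l = 0..N-1
  (this is N^(-1/2) e^(-j(k-1)theta_l) with 1-based indices k,l).\<close>
definition vandermonde :: "nat \<Rightarrow> (nat \<Rightarrow> real) \<Rightarrow> complex mat" where
  "vandermonde N \<theta> =
     mat N N (\<lambda>(k, l). exp (- \<i> * of_nat k * of_real (\<theta> l)) / of_real (sqrt (real N)))"

definition largest_eigenvalue :: "complex mat \<Rightarrow> real" where
  "largest_eigenvalue A = Max {x::real. eigenvalue A (complex_of_real x)}"

definition lambda_max_VV :: "nat \<Rightarrow> (nat \<Rightarrow> real) \<Rightarrow> real" where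
  "lambda_max_VV N \<theta> = largest_eigenvalue (mat_adjoint (vandermonde N \<theta>) * vandermonde N \<theta>)"

definition phase_law :: "(real \<Rightarrow> real) \<Rightarrow> real measure" where
  "phase_law f = density lborel (\<lambda>x. ennreal (f x) * indicator {-pi..pi} x)"

definition phases :: "nat \<Rightarrow> (real \<Rightarrow> real) \<Rightarrow> (nat \<Rightarrow> real) measure" where
  "phases N f = PiM {..<N} (\<lambda>_. phase_law f)"

definition Linf_norm :: "(real \<Rightarrow> real) \<Rightarrow> ereal" where
  "Linf_norm f = esssup (restrict_space lborel {-pi..pi}) (\<lambda>x. ereal \<bar>f x\<bar>)"

end

theory Submission
  imports Defs "Jordan_Normal_Form.Spectral_Radius"
begin

text \<open>
  The entries of \<open>V* V\<close> have modulus \<open>g (\<theta>\<^sub>p - \<theta>\<^sub>q)\<close>, where \<open>g\<close> is the normalised modulus of the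
  Dirichlet kernel, so by Gershgorin an eigenvalue is at most \<open>1 + (\<Sum>q \<noteq> p. g (\<theta>\<^sub>p - \<theta>\<^sub>q))\<close> for some
  \<open>p\<close>. Given \<open>\<theta>\<^sub>p\<close>, the summands are independent with values in \<open>[0, 1]\<close>; there
  \<open>exp x \<le> 1 + (e - 1) x\<close>, and the mean of each is at most \<open>4 \<pi> \<parallel>f\<parallel> (1 + log N) / N\<close> because
  \<open>g x \<le> min 1 (\<pi> / (N \<bar>x\<bar>))\<close> on \<open>[-\<pi>, \<pi>]\<close>. A Chernoff bound at exponent \<open>1\<close> and a union bound over
  the \<open>N\<close> rows give the estimate, with \<open>K = exp C\<close> and for every \<open>N \<ge> 1\<close>.

  Measurability of the event uses that it says that the characteristic polynomial has a zero in a
  compact interval, which by continuity can be tested on a countable dense subset.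
\<close>

section \<open>Elementary inequalities for sine and exponential\<close>

text \<open>The chord of the concave sine over [0, pi/2] lies below the graph. This will bound the
  denominator of the Dirichlet kernel from below.\<close>

lemma jordan_sin_bound:
  fixes y :: real
  assumes "0 \<le> y" "y \<le> pi / 2"
  shows "2 * y / pi \<le> sin y"
proof -
  have "concave_on {0..pi} (sin :: real \<Rightarrow> real)"
    by (rule f''_le0_imp_concave[where f' = cos and f'' = "\<lambda>x. - sin x"])
       (auto intro!: derivative_eq_intros sin_ge_zero)
  then have "(1 - 2 * y / pi) * sin 0 + (2 * y / pi) * sin (pi / 2)
      \<le> sin ((1 - 2 * y / pi) *\<^sub>R 0 + (2 * y / pi) *\<^sub>R (pi / 2))"
    using assms by (intro concave_onD) (auto simp: field_simps)
  then show ?thesis by simp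
qed

text \<open>On [0, 1] the convex exponential stays below its chord. Bounding exponential moments by
  means in this way produces the factor e - 1 in \<open>C\<close>.\<close>

lemma exp_le_chord:
  fixes x :: real
  assumes "0 \<le> x" "x \<le> 1"
  shows "exp x \<le> 1 + (exp 1 - 1) * x"
proof -
  have "convex_on UNIV (exp :: real \<Rightarrow> real)"
    by (rule f''_ge0_imp_convex[where f' = exp and f'' = exp])
       (auto intro!: derivative_eq_intros)
  then have "exp ((1 - x) *\<^sub>R 0 + x *\<^sub>R 1) \<le> (1 - x) * exp 0 + x * exp (1 :: real)"
    using assms by (intro convex_onD) auto
  then show ?thesis by (simp add: algebra_simps)
qed

section \<open>The Dirichlet kernel and its integrable majorant\<close>

definition dirichlet_abs :: "nat \<Rightarrow> real \<Rightarrow> real" where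
  "dirichlet_abs N x = cmod (\<Sum>k<N. cis (real k * x)) / real N"

text \<open>The first branch covers x = 0, where the quotient would be meaningless. The cut-off to
  [-pi, pi] lets integrals be taken over the whole line, where translating the argument does not
  change them.\<close>

definition dirichlet_majorant :: "nat \<Rightarrow> real \<Rightarrow> real" where
  "dirichlet_majorant N x =
     (if real N * \<bar>x\<bar> \<le> pi then 1 else pi / (real N * \<bar>x\<bar>)) * indicator {-pi..pi} x"

lemma dirichlet_abs_nonneg: "0 \<le> dirichlet_abs N x"
  by (simp add: dirichlet_abs_def)

lemma dirichlet_abs_le_1: "dirichlet_abs N x \<le> 1"
proof -
  have "cmod (\<Sum>k<N. cis (real k * x)) \<le> (\<Sum>k<N. cmod (cis (real k * x)))"
    by (rule norm_sum)
  then show ?thesis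
    by (cases "N = 0") (simp_all add: dirichlet_abs_def)
qed

lemma dirichlet_abs_0: "N > 0 \<Longrightarrow> dirichlet_abs N 0 = 1"
  by (simp add: dirichlet_abs_def)

lemma dirichlet_abs_measurable [measurable]: "dirichlet_abs N \<in> borel_measurable borel"
proof -
  have "continuous_on UNIV (\<lambda>x. cmod (\<Sum>k<N. cis (real k * x)))"
    unfolding cis_conv_exp by (intro continuous_intros)
  then have "(\<lambda>x. cmod (\<Sum>k<N. cis (real k * x))) \<in> borel_measurable borel"
    by (rule borel_measurable_continuous_onI)
  then show ?thesis unfolding dirichlet_abs_def[abs_def] by measurable
qed

text \<open>The frequencies are integers, so 2 pi is a period. One period in either direction
  suffices, because differences of points of [-pi, pi] lie in [-2 pi, 2 pi].\<close>

lemma dirichlet_abs_shift: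
  assumes "s = 1 \<or> s = -1"
  shows "dirichlet_abs N (x + s * (2 * pi)) = dirichlet_abs N x"
proof -
  have "cis (real k * (x + s * (2 * pi))) = cis (real k * x)" for k
  proof -
    have "cis (real k * (s * (2 * pi))) = 1"
      using assms cis_multiple_2pi[of "real k"] cis_multiple_2pi[of "- real k"]
      by (auto simp: mult_ac)
    then show ?thesis by (simp add: distrib_left cis_mult[symmetric])
  qed
  then show ?thesis by (simp add: dirichlet_abs_def)
qed

lemma norm_one_minus_cis: "cmod (1 - cis x) = 2 * \<bar>sin (x / 2)\<bar>"
proof -
  have "(cmod (1 - cis x))\<^sup>2 = (1 - cos x)\<^sup>2 + (sin x)\<^sup>2"
    by (simp add: cmod_power2)
  also have "\<dots> = 2 * (1 - cos x)"
    using sin_cos_squared_add[of x] by (simp add: power2_eq_square algebra_simps)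
  also have "\<dots> = (2 * \<bar>sin (x / 2)\<bar>)\<^sup>2"
    using cos_double_sin[of "x / 2"] by (simp add: power_mult_distrib)
  finally show ?thesis by (subst (asm) power2_eq_iff_nonneg) auto
qed

text \<open>The kernel is a geometric sum: its numerator has modulus at most 2, and its denominator
  has modulus 2 |sin (x/2)|, which is at least 2 |x| / pi. The trivial bound 1 covers the
  centre.\<close>

lemma dirichlet_abs_le_majorant:
  assumes "N > 0" "\<bar>x\<bar> \<le> pi"
  shows "dirichlet_abs N x \<le> dirichlet_majorant N x"
proof (cases "x = 0")
  case False
  have "2 * (\<bar>x\<bar> / 2) / pi \<le> sin (\<bar>x\<bar> / 2)"
    using assms by (intro jordan_sin_bound) auto
  also have "\<dots> = \<bar>sin (x / 2)\<bar>"
    using assms sin_ge_zero[of "\<bar>x\<bar>/2"] by (cases "x \<ge> 0") (auto simp: abs_if)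
  finally have sin: "\<bar>x\<bar> / pi \<le> \<bar>sin (x / 2)\<bar>" by simp
  then have sin_pos: "\<bar>sin (x / 2)\<bar> > 0"
    using False by (smt (verit) divide_pos_pos pi_gt_zero)
  have "(1 - cis x) * (\<Sum>k<N. cis (real k * x)) = 1 - cis x ^ N"
    by (simp add: Complex.DeMoivre[symmetric] one_diff_power_eq)
  then have "cmod (1 - cis x) * cmod (\<Sum>k<N. cis (real k * x)) = cmod (1 - cis x ^ N)"
    by (metis norm_mult)
  also have "\<dots> \<le> 2"
    using norm_triangle_ineq4[of 1 "cis x ^ N"] by (simp add: norm_power)
  finally have "\<bar>sin (x / 2)\<bar> * cmod (\<Sum>k<N. cis (real k * x)) \<le> 1"
    by (simp add: norm_one_minus_cis)
  moreover have "\<bar>x\<bar> / pi * cmod (\<Sum>k<N. cis (real k * x)) \<le> \<bar>sin (x / 2)\<bar> * cmod (\<Sum>k<N. cis (real k * x))"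
    by (intro mult_right_mono sin) auto
  ultimately have "\<bar>x\<bar> / pi * cmod (\<Sum>k<N. cis (real k * x)) \<le> 1" by linarith
  then have "dirichlet_abs N x \<le> pi / (real N * \<bar>x\<bar>)"
    using assms False by (simp add: dirichlet_abs_def field_simps)
  then show ?thesis
    using False assms dirichlet_abs_le_1[of N x]
    by (auto simp: dirichlet_majorant_def indicator_def abs_le_iff)
qed (simp add: dirichlet_abs_le_1 dirichlet_majorant_def)

lemma dirichlet_majorant_nonneg: "0 \<le> dirichlet_majorant N x"
  by (simp add: dirichlet_majorant_def)

lemma dirichlet_majorant_measurable [measurable]:
  "dirichlet_majorant N \<in> borel_measurable borel"
  unfolding dirichlet_majorant_def[abs_def] by measurable

lemma nn_integral_inverse_Icc:
  assumes "0 < a" "a \<le> (b::real)" "0 \<le> c"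
  shows "(\<integral>\<^sup>+x. ennreal (c / x) * indicator {a..b} x \<partial>lborel) = ennreal (c * (ln b - ln a))"
proof -
  have "(\<integral>\<^sup>+x. ennreal (c / x) * indicator {a..b} x \<partial>lborel) = ennreal (c * ln b - c * ln a)"
    using assms
    by (intro nn_integral_FTC_Icc) (auto intro!: derivative_eq_intros simp: field_simps)
  then show ?thesis by (simp add: algebra_simps)
qed

text \<open>The plateau of half-width pi / N contributes 2 pi / N, and each of the two tails
  contributes (pi / N) ln N. This is the source of the logarithm in the theorem.\<close>

lemma nn_integral_dirichlet_majorant:
  assumes N: "N > 0"
  shows "(\<integral>\<^sup>+x. dirichlet_majorant N x \<partial>lborel)
    \<le> ennreal (2 * pi * (1 + ln (real N)) / real N)"
proof -
  \<comment> \<open>The two branches of the majorant meet at distance \<open>a\<close> from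
    0.\<close>
  define a where "a = pi / real N"
  define h where "h x = ennreal (pi / real N / x) * indicator {a..pi} x" for x :: real
  have [measurable]: "h \<in> borel_measurable borel" unfolding h_def[abs_def] by measurable
  have a: "0 < a" "a \<le> pi" using N by (auto simp: a_def field_simps)
  define X where "X = pi / real N * ln (real N)"
  have X: "0 \<le> X" using N by (simp add: X_def)
  have h: "(\<integral>\<^sup>+x. h x \<partial>lborel) = ennreal X"
    using nn_integral_inverse_Icc[OF a, of "pi / real N"] N
    by (simp add: h_def a_def X_def ln_div)
  have h': "(\<integral>\<^sup>+x. h (- x) \<partial>lborel) = (\<integral>\<^sup>+x. h x \<partial>lborel)"
    using nn_integral_real_affine[of h "-1" 0] by simp
  have "(\<integral>\<^sup>+x. dirichlet_majorant N x \<partial>lborel)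
      \<le> (\<integral>\<^sup>+x. indicator {-a..a} x + (h x + h (-x)) \<partial>lborel)"
  proof (intro nn_integral_mono)
    fix x :: real
    consider "x \<in> {-a..a}" | "x \<notin> {-pi..pi}" | "a < x" "x \<le> pi" | "x < - a" "- pi \<le> x"
      by fastforce
    then show "ennreal (dirichlet_majorant N x) \<le> indicator {-a..a} x + (h x + h (-x))"
    proof cases
      case 1
      have "dirichlet_majorant N x \<le> 1"
        by (auto simp: dirichlet_majorant_def indicator_def field_simps)
      then have "ennreal (dirichlet_majorant N x) \<le> 1" by simp
      also have "1 \<le> indicator {-a..a} x + (h x + h (-x))"
        using 1 by simp
      finally show ?thesis .
    next
      case 3
      then have "a < \<bar>x\<bar>" by linarith
      then have "pi < real N * \<bar>x\<bar>"
        using N by (simp add: a_def field_simps)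
      then have "dirichlet_majorant N x \<le> pi / real N / x"
        using a 3 by (auto simp: dirichlet_majorant_def indicator_def)
      then have "ennreal (dirichlet_majorant N x) \<le> h x"
        using 3 by (auto simp: h_def intro!: ennreal_leI)
      then show ?thesis by (simp add: add_increasing add_increasing2)
    next
      case 4
      then have "a < \<bar>x\<bar>" by linarith
      then have "pi < real N * \<bar>x\<bar>"
        using N by (simp add: a_def field_simps)
      then have "dirichlet_majorant N x \<le> pi / real N / (- x)"
        using a 4 by (auto simp: dirichlet_majorant_def indicator_def)
      then have "ennreal (dirichlet_majorant N x) \<le> h (- x)"
        using 4 by (auto simp: h_def intro!: ennreal_leI)
      then show ?thesis by (simp add: add_increasing add_increasing2)
    qed (simp add: dirichlet_majorant_def)
  qed
  also have "\<dots> = (\<integral>\<^sup>+x. indicator {-a..a} x \<partial>lborel)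
      + ((\<integral>\<^sup>+x. h x \<partial>lborel) + (\<integral>\<^sup>+x. h (-x) \<partial>lborel))"
    by (simp add: nn_integral_add)
  also have "(\<integral>\<^sup>+x. indicator {-a..a} x \<partial>lborel) = ennreal (2 * a)"
    using a by simp
  also have "ennreal (2 * a) + ((\<integral>\<^sup>+x. h x \<partial>lborel) + (\<integral>\<^sup>+x. h (-x) \<partial>lborel))
      = ennreal (2 * a + (X + X))"
    unfolding h' h using a X by (simp flip: ennreal_plus)
  also have "2 * a + (X + X) = 2 * pi * (1 + ln (real N)) / real N"
    by (simp add: a_def X_def add_divide_distrib distrib_left)
  finally show ?thesis .
qed

section \<open>Eigenvalues: reality and Gershgorin's bound\<close>

lemma eigenvalue_sum_eq:
  fixes A :: "complex mat"
  assumes A: "A \<in> carrier_mat n n" and z: "eigenvalue A z"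
  obtains v :: "nat \<Rightarrow> complex" and i where "i < n" "v i \<noteq> 0"
    "\<And>i. i < n \<Longrightarrow> (\<Sum>j<n. A $$ (i, j) * v j) = z * v i"
proof -
  from z obtain w where "eigenvector A w z" by (auto simp: eigenvalue_def)
  then have w: "w \<in> carrier_vec n" "w \<noteq> 0\<^sub>v n" "A *\<^sub>v w = z \<cdot>\<^sub>v w"
    using A by (auto simp: eigenvector_def)
  obtain i where i: "i < n" "w $ i \<noteq> 0"
    using w by (metis carrier_vecD eq_vecI index_zero_vec)
  show ?thesis
  proof (rule that[of i "\<lambda>i. w $ i"])
    fix i assume "i < n"
    moreover have "(A *\<^sub>v w) $ i = (z \<cdot>\<^sub>v w) $ i" using w by simp
    ultimately show "(\<Sum>j<n. A $$ (i, j) * w $ j) = z * w $ i"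
      using A w(1) by (simp add: scalar_prod_def lessThan_atLeast0)
  qed (use i in auto)
qed

text \<open>The quadratic form of a Hermitian matrix is real, and on an eigenvector it is z times a
  positive number. This matters because \<open>largest_eigenvalue\<close> ranges over real
  eigenvalues only.\<close>

lemma hermitian_eigenvalue_real:
  fixes A :: "complex mat"
  assumes A: "A \<in> carrier_mat n n" and z: "eigenvalue A z"
    and herm: "\<And>i j. i < n \<Longrightarrow> j < n \<Longrightarrow> A $$ (j, i) = cnj (A $$ (i, j))"
  shows "z \<in> \<real>"
proof -
  obtain v :: "nat \<Rightarrow> complex" and i where i: "i < n" "v i \<noteq> 0"
    and v: "\<And>i. i < n \<Longrightarrow> (\<Sum>j<n. A $$ (i, j) * v j) = z * v i"
    using eigenvalue_sum_eq[OF A z] by metis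
  define S where "S = (\<Sum>i<n. \<Sum>j<n. cnj (v i) * (A $$ (i, j) * v j))"
  define r where "r = (\<Sum>i<n. (cmod (v i))\<^sup>2)"
  have "r > 0"
    unfolding r_def using i by (intro sum_pos2[of _ i]) auto
  have "S = (\<Sum>i<n. cnj (v i) * (z * v i))"
    unfolding S_def by (intro sum.cong refl) (simp add: v[symmetric] sum_distrib_left)
  also have "\<dots> = z * of_real r"
    unfolding r_def of_real_sum sum_distrib_left
    by (intro sum.cong refl) (simp only: complex_norm_square mult_ac)
  finally have S: "S = z * of_real r" .
  have "cnj S = (\<Sum>i<n. \<Sum>j<n. cnj (v j) * (A $$ (j, i) * v i))"
    unfolding S_def cnj_sum by (intro sum.cong refl) (simp add: herm[symmetric] mult_ac)
  also have "\<dots> = S" unfolding S_def by (rule sum.swap)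
  finally have "cnj z * of_real r = z * of_real r" by (simp add: S)
  then have "cnj z = z" using \<open>r > 0\<close> by simp
  then show ?thesis by (simp add: Reals_cnj_iff)
qed

text \<open>Read the eigenvalue equation in a row where the eigenvector has its coordinate of
  largest modulus, and divide by that modulus.\<close>

lemma gershgorin:
  fixes A :: "complex mat"
  assumes A: "A \<in> carrier_mat n n" and z: "eigenvalue A z"
  shows "\<exists>p<n. cmod z \<le> (\<Sum>q<n. cmod (A $$ (p, q)))"
proof -
  obtain v :: "nat \<Rightarrow> complex" and i where i: "i < n" "v i \<noteq> 0"
    and v: "\<And>i. i < n \<Longrightarrow> (\<Sum>j<n. A $$ (i, j) * v j) = z * v i"
    using eigenvalue_sum_eq[OF A z] by metis
  define m where "m = Max ((\<lambda>i. cmod (v i)) ` {..<n})"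
  have "m \<in> (\<lambda>i. cmod (v i)) ` {..<n}"
    unfolding m_def using i by (intro Max_in) auto
  then obtain p where p: "p < n" "m = cmod (v p)" by auto
  have m: "cmod (v q) \<le> cmod (v p)" if "q < n" for q
    unfolding p(2)[symmetric] m_def using that by (intro Max_ge) auto
  have "cmod (v p) > 0" using m[OF i(1)] i(2) by (smt (verit) zero_less_norm_iff)
  have "cmod z * cmod (v p) = cmod (\<Sum>q<n. A $$ (p, q) * v q)"
    using v[OF p(1)] by (simp add: norm_mult)
  moreover have "\<dots> \<le> (\<Sum>q<n. cmod (A $$ (p, q)) * cmod (v p))"
    by (rule order_trans[OF norm_sum])
       (auto simp: norm_mult intro!: sum_mono mult_left_mono m)
  ultimately have "cmod z * cmod (v p) \<le> (\<Sum>q<n. cmod (A $$ (p, q))) * cmod (v p)"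
    by (simp add: sum_distrib_right)
  with \<open>cmod (v p) > 0\<close> have "cmod z \<le> (\<Sum>q<n. cmod (A $$ (p, q)))"
    by (simp only: mult_le_cancel_right_pos)
  with p(1) show ?thesis by blast
qed

section \<open>Measurability of eigenvalue events\<close>

lemma char_matrix_index:
  assumes "A \<in> carrier_mat n n" "i < n" "j < n"
  shows "char_matrix A e $$ (i, j) = A $$ (i, j) - (if i = j then e else 0)"
  using assms by (simp add: char_matrix_def)

text \<open>The quantifier over x is uncountable. The bound \<open>B\<close> turns it into the
  question whether a nonnegative continuous function has a zero on a compact interval, that is,
  takes arbitrarily small values on a countable dense subset.\<close>

lemma sets_exists_real_eigenvalue:
  fixes A :: "'a \<Rightarrow> complex mat"
  assumes A: "\<And>\<theta>. A \<theta> \<in> carrier_mat n n"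
    and meas: "\<And>i j. i < n \<Longrightarrow> j < n \<Longrightarrow> (\<lambda>\<theta>. A \<theta> $$ (i, j)) \<in> borel_measurable M"
    and bound: "\<And>\<theta> x. \<theta> \<in> space M \<Longrightarrow> eigenvalue (A \<theta>) (complex_of_real x) \<Longrightarrow> x \<le> B"
  shows "{\<theta> \<in> space M. \<exists>x\<ge>t. eigenvalue (A \<theta>) (complex_of_real x)} \<in> sets M"
proof -
  define d where "d \<theta> x = cmod (Determinant.det (char_matrix (A \<theta>) (complex_of_real x)))" for \<theta> x
  have perm: "p i < n" if "p permutes {0..<n}" "i < n" for p i
    using permutes_in_image[OF that(1), of i] that(2) by simp
  \<comment> \<open>The Leibniz expansion displays the determinant as a polynomial in the entries
    and in x, which yields both measurability in \<theta> and continuity in x.\<close>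
  have d_eq: "d \<theta> x = cmod (\<Sum>p\<in>{p. p permutes {0..<n}}. signof p *
      (\<Prod>i = 0..<n. A \<theta> $$ (i, p i) - (if i = p i then complex_of_real x else 0)))" for \<theta> x
  proof -
    have "Determinant.det (char_matrix (A \<theta>) (complex_of_real x)) =
      (\<Sum>p\<in>{p. p permutes {0..<n}}. signof p *
      (\<Prod>i = 0..<n. char_matrix (A \<theta>) (complex_of_real x) $$ (i, p i)))"
      using A by (intro det_def') auto
    also have "\<dots> = (\<Sum>p\<in>{p. p permutes {0..<n}}. signof p *
      (\<Prod>i = 0..<n. A \<theta> $$ (i, p i) - (if i = p i then complex_of_real x else 0)))"
      by (intro sum.cong prod.cong refl arg_cong2[where f = "(*)"])
         (auto simp: perm char_matrix_index[OF A])
    finally show ?thesis by (simp add: d_def)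
  qed
  have d_meas [measurable]: "(\<lambda>\<theta>. d \<theta> x) \<in> borel_measurable M" for x
    unfolding d_eq
    by (intro measurable_compose[OF _ borel_measurable_norm] borel_measurable_sum borel_measurable_times
        borel_measurable_const borel_measurable_prod borel_measurable_diff meas)
       (auto simp: perm)
  have d_cont: "continuous_on S (d \<theta>)" for \<theta> S
  proof -
    have "continuous_on S (\<lambda>x. if b then complex_of_real x else 0)" for b
      by (cases b) (auto intro!: continuous_intros)
    then show ?thesis unfolding d_eq[abs_def] by (intro continuous_intros) auto
  qed
  have eig: "eigenvalue (A \<theta>) (complex_of_real x) \<longleftrightarrow> d \<theta> x = 0" for \<theta> x
    unfolding d_def using eigenvalue_det[OF A] by simp
  \<comment> \<open>Translating the rationals by \<open>t\<close> puts the left endpoint into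
    \<open>Q\<close>, which settles a zero at \<open>t\<close> itself. The maximum keeps the
    interval nonempty when \<open>B\<close> is below \<open>t\<close>.\<close>
  define Q where "Q = {t..max t B} \<inter> (\<lambda>r. t + r) ` \<rat>"
  have Q: "countable Q" unfolding Q_def by (simp add: countable_rat)
  have "(\<exists>x\<ge>t. eigenvalue (A \<theta>) (complex_of_real x)) \<longleftrightarrow> (\<forall>k::nat. \<exists>x\<in>Q. d \<theta> x < 1 / real (Suc k))"
    if \<theta>: "\<theta> \<in> space M" for \<theta>
  proof
    assume "\<exists>x\<ge>t. eigenvalue (A \<theta>) (complex_of_real x)"
    then obtain x where x: "x \<ge> t" "d \<theta> x = 0" "x \<le> B" using bound[OF \<theta>] eig by metis
    show "\<forall>k::nat. \<exists>y\<in>Q. d \<theta> y < 1 / real (Suc k)"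
    proof
      fix k :: nat
      show "\<exists>y\<in>Q. d \<theta> y < 1 / real (Suc k)"
      proof (cases "x = t")
        case True
        then have "x \<in> Q" unfolding Q_def by (auto intro!: image_eqI[of _ _ 0])
        then show ?thesis using x by (intro bexI[of _ x]) auto
      next
        case False
        have "isCont (d \<theta>) x" using d_cont[of UNIV \<theta>] by (simp add: continuous_on_eq_continuous_at)
        then have "\<forall>\<^sub>F y in at x. d \<theta> y < 1 / real (Suc k)"
          using x by (intro order_tendstoD(2)[of _ "d \<theta> x"]) (auto simp: isCont_def)
        then obtain e where e: "e > 0" "\<And>y. y \<noteq> x \<Longrightarrow> dist y x < e \<Longrightarrow> d \<theta> y < 1 / real (Suc k)"
          unfolding eventually_at by auto
        \<comment> \<open>Approximating x from the left keeps \<open>t + r\<close> between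
          \<open>t\<close> and \<open>B\<close>, hence in \<open>Q\<close>.\<close>
        obtain r where r: "r \<in> \<rat>" "max 0 (x - t - e) < r" "r < x - t"
          using Rats_dense_in_real[of "max 0 (x - t - e)" "x - t"] e(1) x False by auto
        then have "t + r \<in> Q" using x by (auto simp: Q_def)
        moreover have "d \<theta> (t + r) < 1 / real (Suc k)" using r by (intro e) (auto simp: dist_real_def)
        ultimately show ?thesis by blast
      qed
    qed
  next
    assume *: "\<forall>k::nat. \<exists>x\<in>Q. d \<theta> x < 1 / real (Suc k)"
    \<comment> \<open>By compactness the minimum is attained; a positive minimum would exceed some 1
      / (k + 1), contradicting the values found on \<open>Q\<close>.\<close>
    have "\<exists>x\<in>{t..max t B}. \<forall>y\<in>{t..max t B}. d \<theta> x \<le> d \<theta> y"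
      by (intro continuous_attains_inf d_cont) auto
    then obtain x where x: "x \<ge> t" "\<And>y. y \<in> Q \<Longrightarrow> d \<theta> x \<le> d \<theta> y" by (auto simp: Q_def)
    have "d \<theta> x = 0"
    proof (rule ccontr)
      assume "d \<theta> x \<noteq> 0"
      then have "d \<theta> x > 0" by (simp add: d_def)
      then obtain k where "1 / real (Suc k) < d \<theta> x"
        using nat_approx_posE by blast
      then show False using * x(2) by (meson dual_order.strict_trans not_less)
    qed
    then show "\<exists>x\<ge>t. eigenvalue (A \<theta>) (complex_of_real x)" using x eig by auto
  qed
  then have "{\<theta> \<in> space M. \<exists>x\<ge>t. eigenvalue (A \<theta>) (complex_of_real x)} =
      {\<theta> \<in> space M. \<forall>k::nat. \<exists>x\<in>Q. d \<theta> x < 1 / real (Suc k)}" by auto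
  also have "\<dots> \<in> sets M"
    using Q by (intro sets.sets_Collect_countable_All sets.sets_Collect_countable_Bex) auto
  finally show ?thesis .
qed

section \<open>The Gram matrix of the Vandermonde matrix\<close>

definition vandermonde_gram :: "nat \<Rightarrow> (nat \<Rightarrow> real) \<Rightarrow> complex mat" where
  "vandermonde_gram N \<theta> = mat_adjoint (vandermonde N \<theta>) * vandermonde N \<theta>"

lemma vandermonde_gram_carrier: "vandermonde_gram N \<theta> \<in> carrier_mat N N"
  unfolding vandermonde_gram_def
  by (rule mult_carrier_mat[of _ N N]) (auto simp: mat_adjoint_def vandermonde_def)

lemma vandermonde_gram_index:
  assumes "p < N" "q < N"
  shows "vandermonde_gram N \<theta> $$ (p, q) = (\<Sum>k<N. cis (real k * (\<theta> p - \<theta> q))) / of_nat N"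
proof -
  have "vandermonde_gram N \<theta> $$ (p, q) =
      (\<Sum>k<N. cnj (vandermonde N \<theta> $$ (k, p)) * vandermonde N \<theta> $$ (k, q))"
    using assms by (simp add: vandermonde_gram_def mat_adjoint_def vandermonde_def scalar_prod_def
        lessThan_atLeast0)
  also have "\<dots> = (\<Sum>k<N. cis (real k * (\<theta> p - \<theta> q)) / of_nat N)"
  proof (intro sum.cong refl)
    fix k assume "k \<in> {..<N}"
    have e: "exp (- \<i> * of_nat k * complex_of_real x) = cis (- (real k * x))" for x
      by (simp add: cis_conv_exp mult_ac)
    have V: "vandermonde N \<theta> $$ (k, l) = cis (- (real k * \<theta> l)) / of_real (sqrt (real N))"
      if "l < N" for l
      unfolding e[symmetric] using that \<open>k \<in> {..<N}\<close> by (simp add: vandermonde_def)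
    have s: "complex_of_real (sqrt (real N)) * complex_of_real (sqrt (real N)) = of_nat N"
      unfolding of_real_mult[symmetric] by simp
    show "cnj (vandermonde N \<theta> $$ (k, p)) * vandermonde N \<theta> $$ (k, q)
        = cis (real k * (\<theta> p - \<theta> q)) / of_nat N"
      by (simp add: V assms cis_cnj cis_mult s algebra_simps)
  qed
  finally show ?thesis by (simp add: sum_divide_distrib)
qed

lemma norm_vandermonde_gram_index:
  assumes "p < N" "q < N"
  shows "cmod (vandermonde_gram N \<theta> $$ (p, q)) = dirichlet_abs N (\<theta> p - \<theta> q)"
  using assms by (simp add: vandermonde_gram_index dirichlet_abs_def norm_divide)

lemma vandermonde_gram_eigenvalue_real:
  assumes "eigenvalue (vandermonde_gram N \<theta>) z"
  shows "z \<in> \<real>"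
  using vandermonde_gram_carrier assms
proof (rule hermitian_eigenvalue_real)
  fix p q assume "p < N" "q < N"
  then show "vandermonde_gram N \<theta> $$ (q, p) = cnj (vandermonde_gram N \<theta> $$ (p, q))"
    by (simp add: vandermonde_gram_index cis_cnj algebra_simps)
qed

text \<open>Gershgorin's bound with the diagonal entry 1 split off. For i.i.d. phases the remaining
  summands are independent once \<open>\<theta> p\<close> is fixed.\<close>

lemma vandermonde_gram_eigenvalue_le:
  assumes "eigenvalue (vandermonde_gram N \<theta>) (complex_of_real x)"
  shows "\<exists>p<N. x \<le> 1 + (\<Sum>q\<in>{..<N} - {p}. dirichlet_abs N (\<theta> p - \<theta> q))"
proof -
  obtain p where p: "p < N" "\<bar>x\<bar> \<le> (\<Sum>q<N. cmod (vandermonde_gram N \<theta> $$ (p, q)))"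
    using gershgorin[OF vandermonde_gram_carrier assms] by auto
  have "x \<le> (\<Sum>q<N. dirichlet_abs N (\<theta> p - \<theta> q))"
    using p by (simp add: norm_vandermonde_gram_index)
  also have "\<dots> = 1 + (\<Sum>q\<in>{..<N} - {p}. dirichlet_abs N (\<theta> p - \<theta> q))"
    using p(1) by (subst sum.remove[of _ p]) (auto simp: dirichlet_abs_0)
  finally show ?thesis using p(1) by blast
qed

text \<open>\<open>Max\<close> has its meaning only on a finite nonempty set: the spectrum is
  finite, nonempty for \<open>N > 0\<close>, and real because the matrix is Hermitian.\<close>

lemma lambda_max_VV_ge_iff:
  assumes "N > 0"
  shows "lambda_max_VV N \<theta> \<ge> t \<longleftrightarrow> (\<exists>x\<ge>t. eigenvalue (vandermonde_gram N \<theta>) (complex_of_real x))"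
proof -
  let ?E = "{x::real. eigenvalue (vandermonde_gram N \<theta>) (complex_of_real x)}"
  have "finite (complex_of_real -` spectrum (vandermonde_gram N \<theta>))"
    using card_finite_spectrum(1)[OF vandermonde_gram_carrier]
    by (rule finite_vimageI) (simp add: inj_def)
  then have fin: "finite ?E" by (simp add: spectrum_def vimage_def)
  obtain z where z: "eigenvalue (vandermonde_gram N \<theta>) z"
    using spectrum_non_empty[OF vandermonde_gram_carrier assms] by (auto simp: spectrum_def)
  with vandermonde_gram_eigenvalue_real[OF z] have ne: "?E \<noteq> {}" by (auto elim!: Reals_cases)
  show ?thesis
    unfolding lambda_max_VV_def largest_eigenvalue_def vandermonde_gram_def[symmetric]
    using Max_ge_iff[OF fin ne] by auto
qed

lemma sets_lambda_max_VV_ge: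
  assumes N: "N > 0" and M: "sets M = sets (borel :: real measure)"
  shows "{\<theta> \<in> space (PiM {..<N} (\<lambda>_. M)). lambda_max_VV N \<theta> \<ge> t} \<in> sets (PiM {..<N} (\<lambda>_. M))"
  unfolding lambda_max_VV_ge_iff[OF N]
proof (rule sets_exists_real_eigenvalue[OF vandermonde_gram_carrier])
  fix p q assume pq: "p < N" "q < N"
  have comp: "(\<lambda>\<theta>. \<theta> i) \<in> borel_measurable (PiM {..<N} (\<lambda>_. M))" if "i < N" for i
    using measurable_component_singleton[of i "{..<N}" "\<lambda>_. M"] that
    unfolding measurable_cong_sets[OF refl M] by simp
  have [measurable]: "cis \<in> borel_measurable borel"
    by (intro borel_measurable_continuous_onI continuous_intros)
  note [measurable] = comp[OF pq(1)] comp[OF pq(2)]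
  show "(\<lambda>\<theta>. vandermonde_gram N \<theta> $$ (p, q)) \<in> borel_measurable (PiM {..<N} (\<lambda>_. M))"
    unfolding vandermonde_gram_index[OF pq] by measurable
next
  fix \<theta> x assume "eigenvalue (vandermonde_gram N \<theta>) (complex_of_real x)"
  then obtain p where "x \<le> 1 + (\<Sum>q\<in>{..<N} - {p}. dirichlet_abs N (\<theta> p - \<theta> q))"
    using vandermonde_gram_eigenvalue_le by blast
  \<comment> \<open>A crude bound uniform in \<theta> is enough, since it only serves to make the
    interval of candidates compact.\<close>
  also have "(\<Sum>q\<in>{..<N} - {p}. dirichlet_abs N (\<theta> p - \<theta> q)) \<le> (\<Sum>q\<in>{..<N} - {p}. 1)"
    by (intro sum_mono dirichlet_abs_le_1)
  also have "\<dots> \<le> real N"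
    using card_mono[of "{..<N}" "{..<N} - {p}"] by (simp del: card_Diff_insert)
  finally show "x \<le> 1 + real N" by simp
qed

section \<open>The phase law and the mean of a kernel entry\<close>

lemma sets_phase_law [measurable_cong, simp]: "sets (phase_law f) = sets borel"
  by (simp add: phase_law_def)

lemma AE_phase_law_Icc:
  assumes [measurable]: "f \<in> borel_measurable lborel"
  shows "AE x in phase_law f. x \<in> {-pi..pi}"
  unfolding phase_law_def by (subst AE_density) (auto simp: indicator_def)

lemma AE_le_Linf_norm:
  assumes "Linf_norm f < \<infinity>"
  shows "AE x in lborel. x \<in> {-pi..pi} \<longrightarrow> f x \<le> real_of_ereal (Linf_norm f)"
proof -
  have "AE x in restrict_space lborel {-pi..pi}. ereal \<bar>f x\<bar> \<le> Linf_norm f"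
    unfolding Linf_norm_def by (rule esssup_AE)
  then have "AE x in lborel. x \<in> {-pi..pi} \<longrightarrow> ereal \<bar>f x\<bar> \<le> Linf_norm f"
    by (subst (asm) AE_restrict_space_iff) auto
  then show ?thesis
  proof (rule AE_mp, intro AE_I2 impI)
    fix x assume *: "x \<in> {-pi..pi} \<longrightarrow> ereal \<bar>f x\<bar> \<le> Linf_norm f" "x \<in> {-pi..pi}"
    \<comment> \<open>\<open>real_of_ereal\<close> sends both infinities to 0. Plus infinity is
      excluded by assumption, and minus infinity cannot bound |f x| from above.\<close>
    then show "f x \<le> real_of_ereal (Linf_norm f)"
      using assms by (cases "Linf_norm f") auto
  qed
qed

text \<open>The interval has positive measure, so the essential supremum of the constant 0 is 0, and
  monotonicity applies.\<close>

lemma Linf_norm_nonneg: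
  assumes [measurable]: "f \<in> borel_measurable lborel"
  shows "0 \<le> Linf_norm f"
proof -
  have "0 = esssup (restrict_space lborel {-pi..pi}) (\<lambda>x. 0 :: ereal)"
    by (rule esssup_const[symmetric]) (simp add: emeasure_restrict_space space_restrict_space)
  also have "\<dots> \<le> Linf_norm f"
    unfolding Linf_norm_def by (rule esssup_mono) auto
  finally show ?thesis .
qed

text \<open>Shifting by a full period brings every difference of two phases into the interval
  where the majorant applies; the direction depends only on \<open>a\<close>, so two translates suffice.\<close>

lemma dirichlet_abs_diff_le:
  assumes N: "N > 0" and a: "a \<in> {-pi..pi}" and x: "x \<in> {-pi..pi}"
  defines "b \<equiv> a + (if a \<ge> 0 then -1 else 1) * (2 * pi)"
  shows "dirichlet_abs N (a - x) \<le> dirichlet_majorant N (a - x) + dirichlet_majorant N (b - x)"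
proof (cases "\<bar>a - x\<bar> \<le> pi")
  case True
  then show ?thesis
    using dirichlet_abs_le_majorant[OF N True] dirichlet_majorant_nonneg[of N "b - x"] by linarith
next
  case False
  define s :: real where "s = (if a \<ge> 0 then -1 else 1)"
  have "dirichlet_abs N (b - x) = dirichlet_abs N ((a - x) + s * (2 * pi))"
    by (simp add: b_def s_def algebra_simps)
  also have "\<dots> = dirichlet_abs N (a - x)"
    by (rule dirichlet_abs_shift) (simp add: s_def)
  finally have "dirichlet_abs N (a - x) = dirichlet_abs N (b - x)" ..
  moreover have "\<bar>b - x\<bar> \<le> pi"
    using False a x by (auto simp: b_def abs_if split: if_splits)
  ultimately show ?thesis
    using dirichlet_abs_le_majorant[OF N, of "b - x"] dirichlet_majorant_nonneg[of N "a - x"]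
    by linarith
qed

text \<open>The density is at most \<open>B\<close>, and each of the two translates of the majorant
  has integral at most 2 pi (1 + ln N) / N, whence the factor 4 pi. The bound is uniform in
  \<open>a\<close>.\<close>

lemma nn_integral_dirichlet_abs_phase_law:
  assumes [measurable]: "f \<in> borel_measurable lborel"
    and bound: "AE x in lborel. x \<in> {-pi..pi} \<longrightarrow> f x \<le> B" and B: "0 \<le> B"
    and N: "N > 0" and a: "a \<in> {-pi..pi}"
  shows "(\<integral>\<^sup>+x. dirichlet_abs N (a - x) \<partial>phase_law f)
    \<le> ennreal (4 * pi * B * (1 + ln (real N)) / real N)"
proof -
  define b where "b = a + (if a \<ge> 0 then -1 else 1) * (2 * pi)"
  define J where "J = 2 * pi * (1 + ln (real N)) / real N"
  have J: "0 \<le> J" using N by (simp add: J_def)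
  have shift: "(\<integral>\<^sup>+x. dirichlet_majorant N (c - x) \<partial>lborel) \<le> ennreal J" for c
    using nn_integral_real_affine[of "\<lambda>x. ennreal (dirichlet_majorant N x)" "-1" c]
      nn_integral_dirichlet_majorant[OF N] by (simp add: J_def)
  have "(\<integral>\<^sup>+x. dirichlet_abs N (a - x) \<partial>phase_law f)
      = (\<integral>\<^sup>+x. ennreal (f x) * indicator {-pi..pi} x * ennreal (dirichlet_abs N (a - x)) \<partial>lborel)"
    unfolding phase_law_def by (subst nn_integral_density) auto
  also have "\<dots> \<le> (\<integral>\<^sup>+x. ennreal B *
      (ennreal (dirichlet_majorant N (a - x)) + ennreal (dirichlet_majorant N (b - x))) \<partial>lborel)"
  proof (rule nn_integral_mono_AE, use bound in \<open>rule AE_mp\<close>, intro AE_I2 impI)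
    fix x assume *: "x \<in> {-pi..pi} \<longrightarrow> f x \<le> B"
    show "ennreal (f x) * indicator {-pi..pi} x * ennreal (dirichlet_abs N (a - x))
      \<le> ennreal B * (ennreal (dirichlet_majorant N (a - x)) + ennreal (dirichlet_majorant N (b - x)))"
    proof (cases "x \<in> {-pi..pi}")
      case True
      then show ?thesis
        using * dirichlet_abs_diff_le[OF N a True, folded b_def]
        by (auto simp: dirichlet_majorant_nonneg ennreal_plus[symmetric] simp del: ennreal_plus
            intro!: mult_mono ennreal_leI)
    qed simp
  qed
  also have "\<dots> = ennreal B * ((\<integral>\<^sup>+x. dirichlet_majorant N (a - x) \<partial>lborel)
      + (\<integral>\<^sup>+x. dirichlet_majorant N (b - x) \<partial>lborel))"
    by (subst nn_integral_cmult) (auto simp: nn_integral_add)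
  also have "\<dots> \<le> ennreal B * (ennreal J + ennreal J)"
    by (intro mult_left_mono add_mono shift) auto
  also have "\<dots> = ennreal (B * (J + J))"
    using B J by (simp add: ennreal_mult' ennreal_plus[symmetric] del: ennreal_plus)
  also have "B * (J + J) = 4 * pi * B * (1 + ln (real N)) / real N"
    by (simp add: J_def)
  finally show ?thesis .
qed

section \<open>Exponential moments of a row sum\<close>

text \<open>The kernel has values in [0, 1], so by the chord bound its exponential moment exceeds 1
  by at most e - 1 times its mean.\<close>

lemma nn_integral_exp_dirichlet_abs_phase_law:
  assumes f [measurable]: "f \<in> borel_measurable lborel" and prob: "prob_space (phase_law f)"
    and bound: "AE x in lborel. x \<in> {-pi..pi} \<longrightarrow> f x \<le> B" and B: "0 \<le> B"
    and N: "N > 0" and a: "a \<in> {-pi..pi}"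
  shows "(\<integral>\<^sup>+x. exp (dirichlet_abs N (a - x)) \<partial>phase_law f)
    \<le> ennreal (1 + 4 * pi * B * (exp 1 - 1) * (1 + ln (real N)) / real N)"
proof -
  interpret prob_space "phase_law f" by fact
  define I where "I = 4 * pi * B * (1 + ln (real N)) / real N"
  have I: "0 \<le> I" using N B by (simp add: I_def)
  have e: "(0::real) \<le> exp 1 - 1" by simp
  have "(\<integral>\<^sup>+x. exp (dirichlet_abs N (a - x)) \<partial>phase_law f)
      \<le> (\<integral>\<^sup>+x. 1 + ennreal (exp 1 - 1) * ennreal (dirichlet_abs N (a - x)) \<partial>phase_law f)"
  proof (rule nn_integral_mono)
    fix x
    have "ennreal (exp (dirichlet_abs N (a - x))) \<le> ennreal (1 + (exp 1 - 1) * dirichlet_abs N (a - x))"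
      by (intro ennreal_leI exp_le_chord dirichlet_abs_nonneg dirichlet_abs_le_1)
    then show "ennreal (exp (dirichlet_abs N (a - x)))
        \<le> 1 + ennreal (exp 1 - 1) * ennreal (dirichlet_abs N (a - x))"
      using e by (simp add: ennreal_mult' dirichlet_abs_nonneg)
  qed
  also have "\<dots> = 1 + ennreal (exp 1 - 1) * (\<integral>\<^sup>+x. dirichlet_abs N (a - x) \<partial>phase_law f)"
    by (simp add: nn_integral_add nn_integral_cmult emeasure_space_1)
  also have "\<dots> \<le> 1 + ennreal (exp 1 - 1) * ennreal I"
    unfolding I_def
    by (intro add_left_mono mult_left_mono nn_integral_dirichlet_abs_phase_law f bound B N a) simp
  also have "\<dots> = ennreal (1 + (exp 1 - 1) * I)"
    using e I by (simp add: ennreal_mult')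
  also have "(exp 1 - 1) * I = 4 * pi * B * (exp 1 - 1) * (1 + ln (real N)) / real N"
    by (simp add: I_def)
  finally show ?thesis .
qed

text \<open>Conditioning on the phase p makes the factors independent. Each has mean at most 1 + s /
  N, and the product of at most N such bounds is at most exp s.\<close>

lemma nn_integral_prod_exp_dirichlet_abs_phases:
  assumes f [measurable]: "f \<in> borel_measurable lborel" and prob: "prob_space (phase_law f)"
    and bound: "AE x in lborel. x \<in> {-pi..pi} \<longrightarrow> f x \<le> B" and B: "0 \<le> B"
    and p: "p < N"
  shows "(\<integral>\<^sup>+\<theta>. (\<Prod>q\<in>{..<N} - {p}. ennreal (exp (dirichlet_abs N (\<theta> p - \<theta> q)))) \<partial>phases N f)
    \<le> ennreal (exp (4 * pi * B * (exp 1 - 1) * (1 + ln (real N))))"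
proof -
  interpret prob_space "phase_law f" by fact
  interpret product_sigma_finite "\<lambda>_::nat. phase_law f" by standard
  define I where "I = {..<N} - {p}"
  define s where "s = 4 * pi * B * (exp 1 - 1) * (1 + ln (real N))"
  have N: "N > 0" using p by simp
  have s: "0 \<le> s" using N B by (simp add: s_def)
  have I: "finite I" "p \<notin> I" "{..<N} = insert p I" "card I \<le> N"
    using p by (auto simp: I_def)
  have "(\<integral>\<^sup>+\<theta>. (\<Prod>q\<in>I. ennreal (exp (dirichlet_abs N (\<theta> p - \<theta> q)))) \<partial>phases N f)
      = (\<integral>\<^sup>+a. (\<integral>\<^sup>+\<theta>. (\<Prod>q\<in>I. ennreal (exp (dirichlet_abs N (a - \<theta> q))))
          \<partial>PiM I (\<lambda>_. phase_law f)) \<partial>phase_law f)"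
    unfolding phases_def I(3)
  proof (subst product_nn_integral_insert_rev[OF I(1,2)])
    show "(\<lambda>\<theta>. \<Prod>q\<in>I. ennreal (exp (dirichlet_abs N (\<theta> p - \<theta> q))))
        \<in> borel_measurable (PiM (insert p I) (\<lambda>_. phase_law f))"
      by measurable
    have "(\<Prod>q\<in>I. ennreal (exp (dirichlet_abs N ((\<theta>(p := a)) p - (\<theta>(p := a)) q))))
        = (\<Prod>q\<in>I. ennreal (exp (dirichlet_abs N (a - \<theta> q))))" for \<theta> a
      using I(2) by (intro prod.cong) auto
    then show "(\<integral>\<^sup>+a. (\<integral>\<^sup>+\<theta>. (\<Prod>q\<in>I. ennreal (exp (dirichlet_abs N ((\<theta>(p := a)) p - (\<theta>(p := a)) q))))
          \<partial>PiM I (\<lambda>_. phase_law f)) \<partial>phase_law f)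
      = (\<integral>\<^sup>+a. (\<integral>\<^sup>+\<theta>. (\<Prod>q\<in>I. ennreal (exp (dirichlet_abs N (a - \<theta> q))))
          \<partial>PiM I (\<lambda>_. phase_law f)) \<partial>phase_law f)" by simp
  qed
  \<comment> \<open>With \<open>a\<close> fixed the factors depend on distinct coordinates, so the
    inner integral factorises.\<close>
  also have "\<dots> = (\<integral>\<^sup>+a. (\<Prod>q\<in>I. (\<integral>\<^sup>+x. exp (dirichlet_abs N (a - x)) \<partial>phase_law f)) \<partial>phase_law f)"
    by (intro nn_integral_cong product_nn_integral_prod[OF I(1), of "\<lambda>_ x. ennreal (exp (dirichlet_abs N (_ - x)))"]) measurable
  also have "\<dots> \<le> (\<integral>\<^sup>+a. ennreal (exp s) \<partial>phase_law f)"
  \<comment> \<open>The moment bound requires \<open>a\<close> in [-pi, pi], which holds almost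
    surely under the phase law.\<close>
  proof (rule nn_integral_mono_AE, use AE_phase_law_Icc[OF f] in \<open>rule AE_mp\<close>, intro AE_I2 impI)
    fix a assume a: "a \<in> {-pi..pi}"
    have "(\<Prod>q\<in>I. (\<integral>\<^sup>+x. exp (dirichlet_abs N (a - x)) \<partial>phase_law f))
        \<le> (\<Prod>q\<in>I. ennreal (1 + s / real N))"
      unfolding s_def prod_constant
      by (intro power_mono_ennreal nn_integral_exp_dirichlet_abs_phase_law f prob bound B N a)
    also have "\<dots> = ennreal ((1 + s / real N) ^ card I)"
      using s N by (simp add: ennreal_power del: ennreal_plus)
    also have "\<dots> \<le> ennreal (exp s)"
    proof (rule ennreal_leI)
      \<comment> \<open>\<open>I\<close> has one element fewer than N; the base is at least 1, so
        the exponent may be raised.\<close>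
      have "(1 + s / real N) ^ card I \<le> (1 + s / real N) ^ N"
        using s N I(4) by (intro power_increasing) auto
      also have "\<dots> \<le> exp (s / real N) ^ N"
        using s N exp_ge_add_one_self[of "s / real N"] by (intro power_mono) auto
      also have "\<dots> = exp s"
        using N by (simp add: exp_of_nat_mult[symmetric])
      finally show "(1 + s / real N) ^ card I \<le> exp s" .
    qed
    finally show "(\<Prod>q\<in>I. (\<integral>\<^sup>+x. exp (dirichlet_abs N (a - x)) \<partial>phase_law f)) \<le> ennreal (exp s)" .
  qed
  also have "\<dots> = ennreal (exp s)" by (simp add: emeasure_space_1)
  finally show ?thesis unfolding I_def s_def .
qed

section \<open>The tail bound and the theorem\<close>

text \<open>Chernoff's bound with exponent 1, summed over the rows: the factor N is the union bound,
  and the 1 in the exponent is the diagonal entry.\<close>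

lemma measure_lambda_max_VV_ge:
  assumes f [measurable]: "f \<in> borel_measurable lborel" and prob: "prob_space (phase_law f)"
    and bound: "AE x in lborel. x \<in> {-pi..pi} \<longrightarrow> f x \<le> B" and B: "0 \<le> B"
    and N: "N > 0"
  shows "measure (phases N f) {\<theta> \<in> space (phases N f). lambda_max_VV N \<theta> \<ge> t}
    \<le> real N * exp (1 - t + 4 * pi * B * (exp 1 - 1) * (1 + ln (real N)))"
proof -
  define s where "s = 4 * pi * B * (exp 1 - 1) * (1 + ln (real N))"
  define S where "S = {\<theta> \<in> space (phases N f). lambda_max_VV N \<theta> \<ge> t}"
  have S: "S \<in> sets (phases N f)"
    unfolding S_def phases_def by (rule sets_lambda_max_VV_ge[OF N]) simp
  let ?g = "\<lambda>p \<theta>. \<Prod>q\<in>{..<N} - {p}. ennreal (exp (dirichlet_abs N (\<theta> p - \<theta> q)))"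
  have g_meas [measurable]: "?g p \<in> borel_measurable (phases N f)" if "p \<in> {..<N}" for p
    unfolding phases_def using that by measurable
  have "emeasure (phases N f) S = (\<integral>\<^sup>+\<theta>. indicator S \<theta> \<partial>phases N f)"
    using S by simp
  also have "\<dots> \<le> (\<integral>\<^sup>+\<theta>. (\<Sum>p<N. ennreal (exp (1 - t)) * ?g p \<theta>) \<partial>phases N f)"
  proof (rule nn_integral_mono)
    fix \<theta>
    \<comment> \<open>On the event some row p has 1 - t plus its off-diagonal sum nonnegative, so
      already the term of that row is at least 1.\<close>
    show "indicator S \<theta> \<le> (\<Sum>p<N. ennreal (exp (1 - t)) * ?g p \<theta>)"
    proof (cases "\<theta> \<in> S")
      case True
      then obtain x where x: "x \<ge> t" "eigenvalue (vandermonde_gram N \<theta>) (complex_of_real x)"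
        by (auto simp: S_def lambda_max_VV_ge_iff[OF N])
      then obtain p where p: "p < N" "x \<le> 1 + (\<Sum>q\<in>{..<N} - {p}. dirichlet_abs N (\<theta> p - \<theta> q))"
        using vandermonde_gram_eigenvalue_le by blast
      have "1 \<le> ennreal (exp (1 - t + (\<Sum>q\<in>{..<N} - {p}. dirichlet_abs N (\<theta> p - \<theta> q))))"
        using x p by simp
      also have "\<dots> = ennreal (exp (1 - t)) * ?g p \<theta>"
        by (simp only: exp_add exp_sum finite_Diff finite_lessThan)
           (simp add: ennreal_mult prod_nonneg prod_ennreal)
      also have "\<dots> \<le> (\<Sum>p<N. ennreal (exp (1 - t)) * ?g p \<theta>)"
        using p(1) by (intro member_le_sum[of p "{..<N}" "\<lambda>p. ennreal (exp (1 - t)) * ?g p \<theta>"]) auto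
      finally show ?thesis using True by simp
    qed simp
  qed
  also have "\<dots> = (\<Sum>p<N. ennreal (exp (1 - t)) * (\<integral>\<^sup>+\<theta>. ?g p \<theta> \<partial>phases N f))"
    by (subst nn_integral_sum) (auto intro!: sum.cong nn_integral_cmult g_meas borel_measurable_times)
  also have "\<dots> \<le> (\<Sum>p<N. ennreal (exp (1 - t)) * ennreal (exp s))"
    unfolding s_def
    by (intro sum_mono mult_left_mono nn_integral_prod_exp_dirichlet_abs_phases f prob bound B) auto
  also have "\<dots> = ennreal (real N * exp (1 - t + s))"
    by (simp add: exp_add ennreal_mult ennreal_of_nat_eq_real_of_nat mult_ac)
  finally have "emeasure (phases N f) S \<le> ennreal (real N * exp (1 - t + s))" .
  then show ?thesis
    unfolding S_def s_def measure_def by (intro enn2real_leI) auto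
qed

theorem theorem5:
  fixes f :: "real \<Rightarrow> real"
  assumes f_meas: "f \<in> borel_measurable lborel"
    and f_nonneg: "\<And>x. f x \<ge> 0"
    and f_prob: "prob_space (phase_law f)"
    and f_bdd: "Linf_norm f < \<infinity>"
  defines "C \<equiv> 4 * pi * real_of_ereal (Linf_norm f) * (exp 1 - 1) + 1"
  shows "\<exists>K>0. \<forall>\<epsilon>>0. \<forall>\<kappa>::real. 0 < \<kappa> \<and> \<kappa> < 1 \<longrightarrow>
           (\<exists>N0::nat. \<forall>u::real. \<forall>N::nat. u \<ge> 0 \<and> N > N0 \<longrightarrow>
              {\<theta> \<in> space (phases N f). lambda_max_VV N \<theta> \<ge> (C + \<epsilon>) * ln (real N) + u}
                 \<in> sets (phases N f)
            \<and> measure (phases N f)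
                {\<theta> \<in> space (phases N f). lambda_max_VV N \<theta> \<ge> (C + \<epsilon>) * ln (real N) + u}
                \<le> K * exp (- u) / real N powr (\<epsilon> * \<kappa>))"
proof -
  define B where "B = real_of_ereal (Linf_norm f)"
  have B: "0 \<le> B"
    unfolding B_def using Linf_norm_nonneg[OF f_meas] by (rule real_of_ereal_pos)
  have bound: "AE x in lborel. x \<in> {-pi..pi} \<longrightarrow> f x \<le> B"
    unfolding B_def by (rule AE_le_Linf_norm[OF f_bdd])
  have *: "{\<theta> \<in> space (phases N f). lambda_max_VV N \<theta> \<ge> (C + \<epsilon>) * ln (real N) + u} \<in> sets (phases N f)
      \<and> measure (phases N f) {\<theta> \<in> space (phases N f). lambda_max_VV N \<theta> \<ge> (C + \<epsilon>) * ln (real N) + u}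
        \<le> exp C * exp (- u) / real N powr (\<epsilon> * \<kappa>)"
    if "\<epsilon> > 0" "\<kappa> < 1" "N > 0" for \<epsilon> \<kappa> u :: real and N :: nat
  proof
    define L where "L = ln (real N)"
    have L: "0 \<le> L" "real N = exp L" using that by (auto simp: L_def)
    show "{\<theta> \<in> space (phases N f). lambda_max_VV N \<theta> \<ge> (C + \<epsilon>) * ln (real N) + u} \<in> sets (phases N f)"
      unfolding phases_def by (rule sets_lambda_max_VV_ge[OF that(3)]) simp
    have "measure (phases N f) {\<theta> \<in> space (phases N f). lambda_max_VV N \<theta> \<ge> (C + \<epsilon>) * L + u}
        \<le> exp L * exp (1 - ((C + \<epsilon>) * L + u) + 4 * pi * B * (exp 1 - 1) * (1 + L))"
      using measure_lambda_max_VV_ge[OF f_meas f_prob bound B that(3)] by (simp add: L_def that(3))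
    \<comment> \<open>The summand 1 of \<open>C\<close> cancels the factor N = exp \<open>L\<close>,
      and the rest of \<open>C\<close> cancels the moment term in \<open>L\<close>. The constants 1
      and 4 pi B (e - 1) left over add up to \<open>C\<close>.\<close>
    also have "\<dots> = exp (C - u - \<epsilon> * L)"
      by (simp add: exp_add[symmetric] C_def B_def[symmetric] algebra_simps)
    \<comment> \<open>Since \<open>L\<close> \<ge> 0 and \<kappa> < 1, this only weakens the
      decay.\<close>
    also have "\<dots> \<le> exp (C - u - \<epsilon> * \<kappa> * L)"
    proof -
      have "\<epsilon> * (\<kappa> * L) \<le> \<epsilon> * (1 * L)"
        using that L by (intro mult_left_mono mult_right_mono) auto
      then show ?thesis by simp
    qed
    also have "\<dots> = exp C * exp (- u) / real N powr (\<epsilon> * \<kappa>)"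
      by (simp add: L(2) powr_def exp_diff exp_minus exp_add field_simps)
    finally show "measure (phases N f)
        {\<theta> \<in> space (phases N f). lambda_max_VV N \<theta> \<ge> (C + \<epsilon>) * ln (real N) + u}
        \<le> exp C * exp (- u) / real N powr (\<epsilon> * \<kappa>)" by (simp only: L_def)
  qed
  show ?thesis
    \<comment> \<open>The constant depends on \<open>f\<close> alone, so it can be chosen before
      \<epsilon>, \<kappa>, u and N.\<close>
    by (rule exI[of _ "exp C"]) (use * in auto)
qed

end
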